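(* Let $\alpha$ be a finite alphabet with involutions $\tau,\nu:\alpha\to\alpha$ satisfying $\tau\nu=\nu\tau$, let $S_\sharp=\{(a,a,a),(a,a,\nu\tau(a)),(a,\nu\tau(a),\nu\tau(a)) \mid a\in\alpha\}$ be the knotlike homotopy data, and fix a complete system of representatives $L$ of $\alpha/\!\sim_{\tau,\nu}$. Then for every $\diamond\in\{*,0,1,2,G\}$ the map $\mathcal{F}_\diamond:\mathcal{P}(\alpha,\tau)\to\mathcal{P}(\alpha_\diamond,\tau_\diamond)$ induces a well-defined map $$\mathcal{F}_{\diamond\bullet}:\mathcal{P}(\alpha,\tau,S_\sharp,\nu)\to\mathcal{P}(\alpha_\diamond,\tau_\diamond,S_\diamond,\nu_\diamond).$$
   Context: **Nanophrases.** An alphabet is a finite set. An involution is a self-map whose square is the identity (possibly the identity itself). For an alphabet $\alpha$, an $\alpha$-alphabet is a finite set $\mathcal{A}$ with a map (projection) $\mathcal{A}\to\alpha$, $A\mapsto|A|$. A nanophrase of length $k$ over $\alpha$ is a pair $(\mathcal{A},P)$ with $\mathcal{A}$ an $\alpha$-alphabet and $P=w_1|w_2|\cdots|w_k$ a sequence of $k$ (possibly empty) words in $\mathcal{A}$ such that every letter of $\mathcal{A}$ occurs exactly twice in the concatenation $w_1w_2\cdots w_k$. Two nanophrases are isomorphic if they have the same length and there is a projection-preserving bijection of their alphabets carrying each component of the first to the corresponding component of the second. $\mathcal{P}(\alpha,\tau)$ denotes the set of nanophrases over $\alpha$ (with the fixed involution $\tau$). **$S$-homotopy.** For $S\subset\alpha^3$,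 $S$-homotopy is the equivalence relation generated by isomorphisms and the moves below, where $x,y,z,t$ are words in the remaining letters that may contain the separator $|$: (H1) $(\mathcal{A},xAAy)\to(\mathcal{A}\setminus\{A\},xy)$; (H2) $(\mathcal{A},xAByBAz)\to(\mathcal{A}\setminus\{A,B\},xyz)$ if $\tau(|A|)=|B|$; (H3) $(\mathcal{A},xAByACzBCt)\to(\mathcal{A},xBAyCAzCBt)$ if $(|A|,|B|,|C|)\in S$. **$\nu$-shifts and $\nu$-permutations.** The $i$th $\nu$-shift moves the first letter $A$ of $w_i$ to the end of $w_i$; $|A|$ is kept if $A$ occurs once in $w_i$ and is replaced by $\nu(|A|)$ if $A$ occurs twice in $w_i$; everything else is unchanged. The $\nu$-permutation of the $i$th and $(i+1)$st words interchanges $w_i$ and $w_{i+1}$ and replaces $|A|$ by $\nu(|A|)$ for each letter $A$ occurring in both $w_i$ and $w_{i+1}$, keeping all other projections. $\mathcal{P}(\alpha,\tau,S,\nu)$ is the quotient of the set of nanophrases over $\alpha$ by the equivalence relation generated by $S$-homotopy, $\nu$-shifts and $\nu$-permutations. **Target data.** - $\alpha_*=\{a_+,a_-,b_+,b_-\}$, $\tau_*:a_\pm\leftrightarrow b_\mp$, $\nu_*:a_\pm\leftrightarrow b_\pm$, $S_*=\{(a_\pm,a_\pm,a_\pm),(a_\pm,a_\pm,a_\mp),(a_\mp,a_\pm,a_\pm),(b_\pm,b_\pm,b_\pm),(b_\pm,b_\pm,b_\mp),(b_\mp,b_\pm,b_\pm)\}$ (in each triple, all upper or all lower signs). - $\alpha_0=\{a,b\}$,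 $\tau_0=\nu_0:a\leftrightarrow b$, $S_0=\{(a,a,a),(b,b,b)\}$. - $\alpha_1=\{1,-1\}$, $\tau_1:1\leftrightarrow-1$, $\nu_1=\mathrm{id}$, $S_1=\{(1,1,1),(1,1,-1),(-1,1,1),(-1,-1,-1),(-1,-1,1),(1,-1,-1)\}$. - $\alpha_2=\{c,d\}$, $\tau_2=\mathrm{id}$, $\nu_2:c\leftrightarrow d$, $S_2=\{(c,c,c),(c,c,d),(d,c,c),(d,d,d),(d,d,c),(c,d,d)\}$. - $\alpha_G=\{a\}$, $\tau_G=\nu_G=\mathrm{id}$, $S_G=\{(a,a,a)\}$. **The maps $\mathcal{F}_\diamond$.** Let $\sim_{\tau,\nu}$ be the equivalence relation on $\alpha$ generated by $a\sim\tau(a)$ and $a\sim\nu(a)$, and let $L$ be a complete system of representatives. Then $L$ is the disjoint union of $L_*=\{a\in L: a\ne\tau(a),a\neq\nu(a),\tau(a)\ne\nu(a)\}$, $L_0=\{a\in L:a\ne\tau(a),a\ne\nu(a),\tau(a)=\nu(a)\}$, $L_1=\{a\in L:a\ne\tau(a),a=\nu(a)\}$, $L_2=\{a\in L:a=\tau(a),a\ne\nu(a)\}$, $L_G=\{a\in L:a=\tau(a)=\nu(a)\}$. Put $\eta_\diamond=L_\diamond\cup\tau(L_\diamond)\cup\nu(L_\diamond)\cup\tau\nu(L_\diamond)$. For a letter $A$ with $|A|\in\eta_\diamond$ define $p_\diamond(A)\in\alpha_\diamond$ by: $p_*(A)=a_+,\,b_+,\,a_-,\,b_-$ according as $|A|\in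 L_*,\ \nu(L_* ),\ \tau\nu(L_* ),\ \tau(L_* )$; $p_0(A)=a$ if $|A|\in L_0$ and $b$ if $|A|\in\tau(L_0)$; $p_1(A)=1$ if $|A|\in L_1$ and $-1$ if $|A|\in\tau(L_1)$; $p_2(A)=c$ if $|A|\in L_2$ and $d$ if $|A|\in\nu(L_2)$; $p_G(A)=a$ if $|A|\in L_G$. For a nanophrase $(\mathcal{A},P)$ over $\alpha$, $\mathcal{F}_\diamond(\mathcal{A},P)$ is the nanophrase over $\alpha_\diamond$ obtained by deleting from $\mathcal{A}$ and from $P$ (both occurrences) all letters $A$ with $|A|\notin\eta_\diamond$ (keeping all separators, hence the length) and equipping the remaining letters with the projection $p_\diamond$. *)

theory Defs
  imports Main "HOL-Library.FuncSet"
begin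

definition involution_on :: "'a set \<Rightarrow> ('a \<Rightarrow> 'a) \<Rightarrow> bool" where
  "involution_on X f \<longleftrightarrow> f \<in> X \<rightarrow> X \<and> (\<forall>x\<in>X. f (f x) = x)"

text \<open>The equivalence relation on \<open>X\<close> generated by the pairs of elements of \<open>X\<close> related by \<open>R\<close>.\<close>

definition generated_equiv :: "'a set \<Rightarrow> ('a \<Rightarrow> 'a \<Rightarrow> bool) \<Rightarrow> ('a \<times> 'a) set" where
  "generated_equiv X R =
     {(x, y) \<in> X \<times> X. equivclp (\<lambda>u v. u \<in> X \<and> v \<in> X \<and> R u v) x y}"


section \<open>Nanophrases\<close>

text \<open>An \<open>\<alpha>\<close>-alphabet is a partial map with finite domain and values in \<open>\<alpha>\<close>: its domain is the
  set of letters, and the map is the projection. Letters come from an arbitrary type \<open>'l\<close>.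
  A phrase \<open>w\<^sub>1|\<dots>|w\<^sub>k\<close> is the list of its words.\<close>

type_synonym ('l, 'a) nanophrase = "('l \<rightharpoonup> 'a) \<times> 'l list list"

definition nanophrases :: "'a set \<Rightarrow> ('l, 'a) nanophrase set" where
  "nanophrases \<alpha> =
     {(m, ws). finite (dom m) \<and> ran m \<subseteq> \<alpha> \<and> set (concat ws) \<subseteq> dom m \<and>
               (\<forall>A\<in>dom m. count_list (concat ws) A = 2)}"

definition isomorphic :: "('l, 'a) nanophrase \<Rightarrow> ('l, 'a) nanophrase \<Rightarrow> bool" where
  "isomorphic p q \<longleftrightarrow>
     (\<exists>f. bij_betw f (dom (fst p)) (dom (fst q)) \<and>
          (\<forall>A\<in>dom (fst p). fst q (f A) = fst p A) \<and>
          snd q = map (map f) (snd p))"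

text \<open>A word that may contain the separator is a nonempty list of words. Juxtaposing two of them
  concatenates the last word of the first with the first word of the second:
  \<open>(u|v)(w|z) = u|vw|z\<close>.\<close>

definition juxtapose :: "'l list list \<Rightarrow> 'l list list \<Rightarrow> 'l list list" (infixr \<open>\<cdot>\<close> 65) where
  "x \<cdot> y = butlast x @ (last x @ hd y) # tl y"

text \<open>The moves are only used between nanophrases (see \<open>S_homotopy\<close>), where each letter occurs
  exactly twice. Hence the displayed letters are distinct and do not occur in the remaining parts
  \<open>x\<close>, \<open>y\<close>, \<open>z\<close>, \<open>t\<close>.\<close>

inductive homotopy_move ::
  "('a \<Rightarrow> 'a) \<Rightarrow> ('a \<times> 'a \<times> 'a) set \<Rightarrow> ('l, 'a) nanophrase \<Rightarrow> ('l, 'a) nanophrase \<Rightarrow> bool"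
  for \<tau> S where
  H1: "\<lbrakk>x \<noteq> []; y \<noteq> []\<rbrakk> \<Longrightarrow>
       homotopy_move \<tau> S (m, x \<cdot> [[A, A]] \<cdot> y) (m(A := None), x \<cdot> y)"
| H2: "\<lbrakk>x \<noteq> []; y \<noteq> []; z \<noteq> []; m A = Some a; m B = Some b; \<tau> a = b\<rbrakk> \<Longrightarrow>
       homotopy_move \<tau> S (m, x \<cdot> [[A, B]] \<cdot> y \<cdot> [[B, A]] \<cdot> z)
                         (m(A := None, B := None), x \<cdot> y \<cdot> z)"
| H3: "\<lbrakk>x \<noteq> []; y \<noteq> []; z \<noteq> []; t \<noteq> [];
        m A = Some a; m B = Some b; m C = Some c; (a, b, c) \<in> S\<rbrakk> \<Longrightarrow>
       homotopy_move \<tau> S (m, x \<cdot> [[A, B]] \<cdot> y \<cdot> [[A, C]] \<cdot> z \<cdot> [[B, C]] \<cdot> t)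
                         (m, x \<cdot> [[B, A]] \<cdot> y \<cdot> [[C, A]] \<cdot> z \<cdot> [[C, B]] \<cdot> t)"

definition S_homotopy ::
  "'a set \<Rightarrow> ('a \<Rightarrow> 'a) \<Rightarrow> ('a \<times> 'a \<times> 'a) set \<Rightarrow> (('l, 'a) nanophrase \<times> ('l, 'a) nanophrase) set"
  where
  "S_homotopy \<alpha> \<tau> S =
     generated_equiv (nanophrases \<alpha>) (\<lambda>p q. isomorphic p q \<or> homotopy_move \<tau> S p q)"

text \<open>Words are indexed from 0.\<close>

inductive nu_shift :: "('a \<Rightarrow> 'a) \<Rightarrow> ('l, 'a) nanophrase \<Rightarrow> ('l, 'a) nanophrase \<Rightarrow> bool"
  for \<nu> where
  "\<lbrakk>i < length ws; ws ! i = A # u;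
    m' = (if count_list (ws ! i) A = 2 then m(A := map_option \<nu> (m A)) else m)\<rbrakk> \<Longrightarrow>
   nu_shift \<nu> (m, ws) (m', ws[i := u @ [A]])"

inductive nu_permutation :: "('a \<Rightarrow> 'a) \<Rightarrow> ('l, 'a) nanophrase \<Rightarrow> ('l, 'a) nanophrase \<Rightarrow> bool"
  for \<nu> where
  "\<lbrakk>Suc i < length ws;
    m' = (\<lambda>A. if A \<in> set (ws ! i) \<and> A \<in> set (ws ! Suc i) then map_option \<nu> (m A) else m A)\<rbrakk> \<Longrightarrow>
   nu_permutation \<nu> (m, ws) (m', ws[i := ws ! Suc i, Suc i := ws ! i])"

definition nanophrase_equiv ::
  "'a set \<Rightarrow> ('a \<Rightarrow> 'a) \<Rightarrow> ('a \<times> 'a \<times> 'a) set \<Rightarrow> ('a \<Rightarrow> 'a) \<Rightarrow>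
   (('l, 'a) nanophrase \<times> ('l, 'a) nanophrase) set" where
  "nanophrase_equiv \<alpha> \<tau> S \<nu> =
     generated_equiv (nanophrases \<alpha>)
       (\<lambda>p q. (p, q) \<in> S_homotopy \<alpha> \<tau> S \<or> nu_shift \<nu> p q \<or> nu_permutation \<nu> p q)"

definition nanophrase_classes ::
  "'a set \<Rightarrow> ('a \<Rightarrow> 'a) \<Rightarrow> ('a \<times> 'a \<times> 'a) set \<Rightarrow> ('a \<Rightarrow> 'a) \<Rightarrow> ('l, 'a) nanophrase set set" where
  "nanophrase_classes \<alpha> \<tau> S \<nu> = nanophrases \<alpha> // nanophrase_equiv \<alpha> \<tau> S \<nu>"

definition S_sharp :: "'a set \<Rightarrow> ('a \<Rightarrow> 'a) \<Rightarrow> ('a \<Rightarrow> 'a) \<Rightarrow> ('a \<times> 'a \<times> 'a) set" where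
  "S_sharp \<alpha> \<tau> \<nu> =
     (\<Union>a\<in>\<alpha>. {(a, a, a), (a, a, \<nu> (\<tau> a)), (a, \<nu> (\<tau> a), \<nu> (\<tau> a))})"


section \<open>Target data\<close>

datatype diamond = Star | Zero | One | Two | Gauss

text \<open>One type contains the symbols of all five target alphabets. \<open>Sa\<close> serves both in
  \<open>\<alpha>\<^sub>0 = {a, b}\<close> and in \<open>\<alpha>\<^sub>G = {a}\<close>. The values of \<open>tau_target\<close> and \<open>nu_target\<close> outside the
  respective alphabet are irrelevant.\<close>

datatype target_symbol =
  Aplus | Aminus | Bplus | Bminus | Sa | Sb | Plus_one | Minus_one | Sc | Sd

fun alpha_target :: "diamond \<Rightarrow> target_symbol set" where
  "alpha_target Star = {Aplus, Aminus, Bplus, Bminus}"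
| "alpha_target Zero = {Sa, Sb}"
| "alpha_target One = {Plus_one, Minus_one}"
| "alpha_target Two = {Sc, Sd}"
| "alpha_target Gauss = {Sa}"

fun tau_target :: "diamond \<Rightarrow> target_symbol \<Rightarrow> target_symbol" where
  "tau_target Star = id(Aplus := Bminus, Bminus := Aplus, Aminus := Bplus, Bplus := Aminus)"
| "tau_target Zero = id(Sa := Sb, Sb := Sa)"
| "tau_target One = id(Plus_one := Minus_one, Minus_one := Plus_one)"
| "tau_target Two = id"
| "tau_target Gauss = id"

fun nu_target :: "diamond \<Rightarrow> target_symbol \<Rightarrow> target_symbol" where
  "nu_target Star = id(Aplus := Bplus, Bplus := Aplus, Aminus := Bminus, Bminus := Aminus)"
| "nu_target Zero = id(Sa := Sb, Sb := Sa)"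
| "nu_target One = id"
| "nu_target Two = id(Sc := Sd, Sd := Sc)"
| "nu_target Gauss = id"

fun S_target :: "diamond \<Rightarrow> (target_symbol \<times> target_symbol \<times> target_symbol) set" where
  "S_target Star =
     {(Aplus, Aplus, Aplus), (Aminus, Aminus, Aminus),
      (Aplus, Aplus, Aminus), (Aminus, Aminus, Aplus),
      (Aminus, Aplus, Aplus), (Aplus, Aminus, Aminus),
      (Bplus, Bplus, Bplus), (Bminus, Bminus, Bminus),
      (Bplus, Bplus, Bminus), (Bminus, Bminus, Bplus),
      (Bminus, Bplus, Bplus), (Bplus, Bminus, Bminus)}"
| "S_target Zero = {(Sa, Sa, Sa), (Sb, Sb, Sb)}"
| "S_target One =
     {(Plus_one, Plus_one, Plus_one), (Plus_one, Plus_one, Minus_one),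
      (Minus_one, Plus_one, Plus_one), (Minus_one, Minus_one, Minus_one),
      (Minus_one, Minus_one, Plus_one), (Plus_one, Minus_one, Minus_one)}"
| "S_target Two =
     {(Sc, Sc, Sc), (Sc, Sc, Sd), (Sd, Sc, Sc), (Sd, Sd, Sd), (Sd, Sd, Sc), (Sc, Sd, Sd)}"
| "S_target Gauss = {(Sa, Sa, Sa)}"


section \<open>The maps from nanophrases over the given alphabet to the target alphabets\<close>

definition orbit_equiv :: "'a set \<Rightarrow> ('a \<Rightarrow> 'a) \<Rightarrow> ('a \<Rightarrow> 'a) \<Rightarrow> ('a \<times> 'a) set" where
  "orbit_equiv \<alpha> \<tau> \<nu> = generated_equiv \<alpha> (\<lambda>a b. b = \<tau> a \<or> b = \<nu> a)"

definition complete_representatives :: "'a set \<Rightarrow> ('a \<times> 'a) set \<Rightarrow> 'a set \<Rightarrow> bool" where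
  "complete_representatives X E L \<longleftrightarrow> L \<subseteq> X \<and> (\<forall>C\<in>X // E. \<exists>!a. a \<in> L \<inter> C)"

fun L_part :: "diamond \<Rightarrow> ('a \<Rightarrow> 'a) \<Rightarrow> ('a \<Rightarrow> 'a) \<Rightarrow> 'a set \<Rightarrow> 'a set" where
  "L_part Star \<tau> \<nu> L = {a \<in> L. a \<noteq> \<tau> a \<and> a \<noteq> \<nu> a \<and> \<tau> a \<noteq> \<nu> a}"
| "L_part Zero \<tau> \<nu> L = {a \<in> L. a \<noteq> \<tau> a \<and> a \<noteq> \<nu> a \<and> \<tau> a = \<nu> a}"
| "L_part One \<tau> \<nu> L = {a \<in> L. a \<noteq> \<tau> a \<and> a = \<nu> a}"
| "L_part Two \<tau> \<nu> L = {a \<in> L. a = \<tau> a \<and> a \<noteq> \<nu> a}"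
| "L_part Gauss \<tau> \<nu> L = {a \<in> L. a = \<tau> a \<and> \<tau> a = \<nu> a}"

definition eta :: "diamond \<Rightarrow> ('a \<Rightarrow> 'a) \<Rightarrow> ('a \<Rightarrow> 'a) \<Rightarrow> 'a set \<Rightarrow> 'a set" where
  "eta d \<tau> \<nu> L =
     L_part d \<tau> \<nu> L \<union> \<tau> ` L_part d \<tau> \<nu> L \<union> \<nu> ` L_part d \<tau> \<nu> L \<union> (\<tau> \<circ> \<nu>) ` L_part d \<tau> \<nu> L"

text \<open>The new projection of a letter in terms of its old one. It is only used on \<open>eta d \<tau> \<nu> L\<close>,
  so the final branches stand for membership in \<open>\<tau>(L\<^sub>*)\<close>, \<open>\<tau>(L\<^sub>0)\<close>, \<open>\<tau>(L\<^sub>1)\<close>, \<open>\<nu>(L\<^sub>2)\<close>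
  and \<open>L\<^sub>G\<close>, respectively.\<close>

fun p_map :: "diamond \<Rightarrow> ('a \<Rightarrow> 'a) \<Rightarrow> ('a \<Rightarrow> 'a) \<Rightarrow> 'a set \<Rightarrow> 'a \<Rightarrow> target_symbol" where
  "p_map Star \<tau> \<nu> L a =
     (if a \<in> L_part Star \<tau> \<nu> L then Aplus
      else if a \<in> \<nu> ` L_part Star \<tau> \<nu> L then Bplus
      else if a \<in> (\<tau> \<circ> \<nu>) ` L_part Star \<tau> \<nu> L then Aminus
      else Bminus)"
| "p_map Zero \<tau> \<nu> L a = (if a \<in> L_part Zero \<tau> \<nu> L then Sa else Sb)"
| "p_map One \<tau> \<nu> L a = (if a \<in> L_part One \<tau> \<nu> L then Plus_one else Minus_one)"
| "p_map Two \<tau> \<nu> L a = (if a \<in> L_part Two \<tau> \<nu> L then Sc else Sd)"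
| "p_map Gauss \<tau> \<nu> L a = Sa"

definition F_map ::
  "diamond \<Rightarrow> ('a \<Rightarrow> 'a) \<Rightarrow> ('a \<Rightarrow> 'a) \<Rightarrow> 'a set \<Rightarrow>
   ('l, 'a) nanophrase \<Rightarrow> ('l, target_symbol) nanophrase" where
  "F_map d \<tau> \<nu> L = (\<lambda>(m, ws).
     (\<lambda>A. case m A of None \<Rightarrow> None
          | Some a \<Rightarrow> if a \<in> eta d \<tau> \<nu> L then Some (p_map d \<tau> \<nu> L a) else None,
      map (filter (\<lambda>A. \<exists>a\<in>eta d \<tau> \<nu> L. m A = Some a)) ws))"

end

theory Submission
  imports Defs
begin

text \<open>
  Each of the maps \<open>F_map\<close> does the same thing: it keeps the letters whose projection lies in a
  set \<open>E\<close> and applies a function \<open>p\<close> to the projections of those. Such a map respects the moves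
  as soon as \<open>E\<close> and \<open>p\<close> are compatible with the structure on the alphabet: \<open>E\<close> is closed under
  \<open>\<tau>\<close> and \<open>\<nu>\<close> and contains all or none of the entries of each triple in \<open>S\<close>, while \<open>p\<close>
  intertwines the involutions and carries the triples in \<open>S\<close> with entries in \<open>E\<close> to admissible
  triples. Indeed, the letters displayed in a homotopy move are then all kept or all deleted. If they
  are kept, the move becomes a move of the same type; if they are deleted, both sides have the same
  image. A \<open>\<nu>\<close>-shift likewise becomes a \<open>\<nu>\<close>-shift or, if the moved letter is deleted, an
  equality, because the new projection of that letter is still outside \<open>E\<close>. Isomorphisms and
  \<open>\<nu>\<close>-permutations are always carried to moves of the same kind. The locale
  \<open>homotopy_data_map\<close> isolates these conditions, and \<open>project_equiv\<close> is its conclusion.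

  It remains to verify the conditions for \<open>E = eta d \<tau> \<nu> L\<close>. This set is a union of orbits
  of the group generated by the commuting involutions \<open>\<tau>\<close> and \<open>\<nu>\<close>, and \<open>L\<close> meets each orbit in
  exactly one point \<open>x\<close>. The five cases for \<open>d\<close> are the five possible stabilizers of \<open>x\<close> in the
  Klein four-group, and the target alphabet is the corresponding transitive set; so \<open>p_map\<close> is
  the equivariant map sending \<open>x\<close> to the base point (\<open>p_map_equivariant\<close>). Since every triple of
  \<open>S_sharp\<close> is built from \<open>a\<close> and \<open>\<nu>(\<tau>(a))\<close>, equivariance reduces the condition on triples to
  a statement about the target data (\<open>S_target_knotlike\<close>).
\<close>

section \<open>Generated equivalence relations\<close>

lemma equiv_generated_equiv: "equiv X (generated_equiv X R)"
  unfolding generated_equiv_def equiv_def refl_on_def sym_def trans_def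
  by (auto intro: equivclp_sym equivclp_trans)

lemma generated_equiv_base:
  "\<lbrakk>x \<in> X; y \<in> X; R x y\<rbrakk> \<Longrightarrow> (x, y) \<in> generated_equiv X R"
  unfolding generated_equiv_def by (auto dest: r_into_equivclp)

lemma generated_equiv_subset:
  assumes "(x, y) \<in> generated_equiv X R"
    and E: "equiv X E"
    and base: "\<And>u v. \<lbrakk>u \<in> X; v \<in> X; R u v\<rbrakk> \<Longrightarrow> (u, v) \<in> E"
  shows "(x, y) \<in> E"
proof -
  have "x \<in> X" and "equivclp (\<lambda>u v. u \<in> X \<and> v \<in> X \<and> R u v) x y"
    using assms(1) by (auto simp: generated_equiv_def)
  from this(2) show ?thesis
  proof (induction rule: equivclp_induct)
    case base
    then show ?case using E \<open>x \<in> X\<close> by (auto elim: equivE dest: refl_onD)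
  next
    case (step y z)
    then have "(y, z) \<in> E"
      using base E by (metis equivE symD)
    with step.IH E show ?case by (meson equivE transD)
  qed
qed

text \<open>The relation that \<open>f\<close> pulls back from \<open>E\<close> is an equivalence relation, so it suffices to
  check that it contains the generators.\<close>

lemma generated_equiv_map:
  assumes "(x, y) \<in> generated_equiv X R"
    and E: "equiv Y E" and f: "f \<in> X \<rightarrow> Y"
    and "\<And>u v. \<lbrakk>u \<in> X; v \<in> X; R u v\<rbrakk> \<Longrightarrow> (f u, f v) \<in> E"
  shows "(f x, f y) \<in> E"
proof -
  have "equiv X {(u, v). u \<in> X \<and> v \<in> X \<and> (f u, f v) \<in> E}"
  proof (rule equivI)
    show "refl_on X {(u, v). u \<in> X \<and> v \<in> X \<and> (f u, f v) \<in> E}"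
      using E f by (auto simp: equiv_def Pi_iff intro!: refl_onI dest: refl_onD)
    show "sym {(u, v). u \<in> X \<and> v \<in> X \<and> (f u, f v) \<in> E}"
      using E by (auto simp: equiv_def intro!: symI dest: symD)
    show "trans {(u, v). u \<in> X \<and> v \<in> X \<and> (f u, f v) \<in> E}"
      using E by (auto simp: equiv_def intro!: transI dest: transD)
  qed auto
  from generated_equiv_subset[OF assms(1) this] assms(4) show ?thesis by auto
qed

lemma ex1_induced_quotient_map:
  assumes RX: "equiv X RX" and RY: "equiv Y RY" and f: "f \<in> X \<rightarrow> Y"
    and resp: "\<And>x y. (x, y) \<in> RX \<Longrightarrow> (f x, f y) \<in> RY"
  shows "\<exists>!\<Phi>. \<Phi> \<in> X // RX \<rightarrow>\<^sub>E Y // RY \<and> (\<forall>x\<in>X. \<Phi> (RX `` {x}) = RY `` {f x})"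
proof (rule ex1I)
  define \<Phi> where "\<Phi> = (\<lambda>C\<in>X // RX. RY `` {f (SOME x. x \<in> C)})"
  have val: "\<Phi> (RX `` {x}) = RY `` {f x}" if "x \<in> X" for x
  proof -
    have "x \<in> RX `` {x}" using RX that by (rule equiv_class_self)
    then have "(x, SOME y. y \<in> RX `` {x}) \<in> RX"
      by (metis Image_singleton_iff someI)
    then have "RY `` {f x} = RY `` {f (SOME y. y \<in> RX `` {x})}"
      by (intro equiv_class_eq[OF RY] resp)
    then show ?thesis using that by (simp add: \<Phi>_def quotientI)
  qed
  have "\<Phi> C \<in> Y // RY" if "C \<in> X // RX" for C
    using that val f by (auto elim!: quotientE intro!: quotientI)
  then show "\<Phi> \<in> X // RX \<rightarrow>\<^sub>E Y // RY \<and> (\<forall>x\<in>X. \<Phi> (RX `` {x}) = RY `` {f x})"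
    using val by (auto simp: \<Phi>_def)
  fix \<Psi>
  assume \<Psi>: "\<Psi> \<in> X // RX \<rightarrow>\<^sub>E Y // RY \<and> (\<forall>x\<in>X. \<Psi> (RX `` {x}) = RY `` {f x})"
  show "\<Psi> = \<Phi>"
  proof
    fix C
    show "\<Psi> C = \<Phi> C"
    proof (cases "C \<in> X // RX")
      case True
      then show ?thesis using \<Psi> val by (auto elim!: quotientE)
    next
      case False
      then show ?thesis using \<Psi> by (auto simp: \<Phi>_def)
    qed
  qed
qed


section \<open>Juxtaposition\<close>

lemma juxtapose_ne_Nil [simp]: "x \<cdot> y \<noteq> []"
  by (simp add: juxtapose_def)

lemma juxtapose_empty_word: "y \<noteq> [] \<Longrightarrow> [[]] \<cdot> y = y"
  by (simp add: juxtapose_def)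

lemma concat_juxtapose: "\<lbrakk>x \<noteq> []; y \<noteq> []\<rbrakk> \<Longrightarrow> concat (x \<cdot> y) = concat x @ concat y"
  by (cases x rule: rev_cases; cases y) (auto simp: juxtapose_def)


section \<open>Deleting and relabelling letters\<close>

text \<open>The construction common to the five maps \<open>F_map\<close>, for an arbitrary set \<open>E\<close> of projections
  and an arbitrary function \<open>p\<close>.\<close>

definition relabel :: "'a set \<Rightarrow> ('a \<Rightarrow> 'b) \<Rightarrow> ('l \<rightharpoonup> 'a) \<Rightarrow> ('l \<rightharpoonup> 'b)" where
  "relabel E p m =
     (\<lambda>A. case m A of None \<Rightarrow> None | Some a \<Rightarrow> if a \<in> E then Some (p a) else None)"

definition keep :: "'a set \<Rightarrow> ('l \<rightharpoonup> 'a) \<Rightarrow> 'l list list \<Rightarrow> 'l list list" where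
  "keep E m = map (filter (\<lambda>A. \<exists>a\<in>E. m A = Some a))"

definition project :: "'a set \<Rightarrow> ('a \<Rightarrow> 'b) \<Rightarrow> ('l, 'a) nanophrase \<Rightarrow> ('l, 'b) nanophrase" where
  "project E p = (\<lambda>(m, ws). (relabel E p m, keep E m ws))"

lemma F_map_eq_project: "F_map d \<tau> \<nu> L = project (eta d \<tau> \<nu> L) (p_map d \<tau> \<nu> L)"
  by (simp add: F_map_def project_def relabel_def keep_def)

lemma dom_relabel: "dom (relabel E p m) = {A. \<exists>a\<in>E. m A = Some a}"
  by (auto simp: relabel_def split: option.splits if_splits)

lemma relabel_eq_Some: "\<lbrakk>m A = Some a; a \<in> E\<rbrakk> \<Longrightarrow> relabel E p m A = Some (p a)"
  by (simp add: relabel_def)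

lemma relabel_delete: "relabel E p (m(A := None)) = (relabel E p m)(A := None)"
  by (auto simp: relabel_def)

lemma keep_eq_Nil_iff [simp]: "keep E m x = [] \<longleftrightarrow> x = []"
  by (simp add: keep_def)

text \<open>Deleting letters never removes a separator. Hence it acts on a displayed decomposition
  of a phrase piece by piece, and a displayed word all of whose letters are deleted becomes the
  empty word, which juxtaposition absorbs by \<open>juxtapose_empty_word\<close>.\<close>

lemma keep_juxtapose:
  "\<lbrakk>x \<noteq> []; y \<noteq> []\<rbrakk> \<Longrightarrow> keep E m (x \<cdot> y) = keep E m x \<cdot> keep E m y"
  by (simp add: keep_def juxtapose_def map_butlast last_map hd_map map_tl)

lemma keep_cong:
  assumes "\<And>A. A \<in> set (concat ws) \<Longrightarrow> (\<exists>a\<in>E. m A = Some a) \<longleftrightarrow> (\<exists>a\<in>E. m' A = Some a)"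
  shows "keep E m ws = keep E m' ws"
  using assms unfolding keep_def by (auto intro!: filter_cong)

lemma keep_delete: "A \<notin> set (concat ws) \<Longrightarrow> keep E (m(A := None)) ws = keep E m ws"
  by (rule keep_cong) auto

lemma concat_keep: "concat (keep E m ws) = filter (\<lambda>A. \<exists>a\<in>E. m A = Some a) (concat ws)"
  by (simp add: keep_def filter_concat)

lemma count_list_filter: "P A \<Longrightarrow> count_list (filter P xs) A = count_list xs A"
  by (induction xs) auto

lemma project_in_nanophrases:
  assumes "q \<in> nanophrases \<alpha>" and "\<And>a. \<lbrakk>a \<in> \<alpha>; a \<in> E\<rbrakk> \<Longrightarrow> p a \<in> \<beta>"
  shows "project E p q \<in> nanophrases \<beta>"
proof -
  obtain m ws where q: "q = (m, ws)" by fastforce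
  have sub: "dom (relabel E p m) \<subseteq> dom m" by (auto simp: dom_relabel)
  have "finite (dom (relabel E p m))"
    using assms(1) sub by (auto simp: q nanophrases_def dest: finite_subset)
  moreover have "ran (relabel E p m) \<subseteq> \<beta>"
    using assms by (auto simp: q nanophrases_def ran_def relabel_def split: option.splits if_splits)
  moreover have "count_list (concat (keep E m ws)) A = 2" if "A \<in> dom (relabel E p m)" for A
    using that assms(1) by (auto simp: q nanophrases_def dom_relabel concat_keep count_list_filter)
  ultimately show ?thesis
    by (auto simp: q nanophrases_def project_def dom_relabel concat_keep simp del: set_concat)
qed

lemma isomorphic_project:
  assumes "isomorphic q r" "q \<in> nanophrases \<alpha>"
  shows "isomorphic (project E p q) (project E p r)"
proof -
  obtain m ws where q: "q = (m, ws)" by fastforce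
  obtain n vs where r: "r = (n, vs)" by fastforce
  obtain f where bij: "bij_betw f (dom m) (dom n)" and lab: "\<And>A. A \<in> dom m \<Longrightarrow> n (f A) = m A"
    and vs: "vs = map (map f) ws"
    using assms(1) by (auto simp: isomorphic_def q r)
  have letters: "set (concat ws) \<subseteq> dom m"
    using assms(2) by (auto simp: q nanophrases_def)
  have "bij_betw f (dom (relabel E p m)) (dom (relabel E p n))"
  proof (rule bij_betw_subset[OF bij])
    show "f ` dom (relabel E p m) = dom (relabel E p n)"
    proof (intro equalityI subsetI)
      fix B assume "B \<in> dom (relabel E p n)"
      then obtain b where b: "b \<in> E" "n B = Some b" by (auto simp: dom_relabel)
      then have "B \<in> f ` dom m" using bij by (auto simp: bij_betw_def)
      then obtain A where "A \<in> dom m" "B = f A" by blast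
      with b lab show "B \<in> f ` dom (relabel E p m)" by (force simp: dom_relabel)
    qed (auto simp: dom_relabel lab domIff)
  qed (auto simp: dom_relabel)
  moreover have "relabel E p n (f A) = relabel E p m A" if "A \<in> dom (relabel E p m)" for A
  proof -
    have "A \<in> dom m" using that by (auto simp: dom_relabel)
    then show ?thesis by (simp add: relabel_def lab)
  qed
  moreover have "keep E n vs = map (map f) (keep E m ws)"
    unfolding keep_def vs map_map
  proof (rule map_cong[OF refl])
    fix w assume "w \<in> set ws"
    then have "n (f A) = m A" if "A \<in> set w" for A
      using that letters lab by auto
    then show "(filter (\<lambda>B. \<exists>b\<in>E. n B = Some b) \<circ> map f) w =
        (map f \<circ> filter (\<lambda>A. \<exists>a\<in>E. m A = Some a)) w"
      by (auto simp: filter_map intro!: arg_cong[of _ _ "map f"] filter_cong)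
  qed
  ultimately show ?thesis
    unfolding isomorphic_def q r project_def by auto
qed


section \<open>Maps of homotopy data\<close>

text \<open>The conditions under which \<open>project E p\<close> descends to equivalence classes. The closure
  conditions make the letters displayed in a move be kept or deleted together, and keep that
  status when \<open>\<nu>\<close> changes a projection.\<close>

locale homotopy_data_map =
  fixes \<alpha> :: "'a set" and \<tau> \<nu> :: "'a \<Rightarrow> 'a" and S :: "('a \<times> 'a \<times> 'a) set"
    and \<beta> :: "'b set" and \<tau>' \<nu>' :: "'b \<Rightarrow> 'b" and S' :: "('b \<times> 'b \<times> 'b) set"
    and E :: "'a set" and p :: "'a \<Rightarrow> 'b"
  assumes p_in: "\<lbrakk>a \<in> \<alpha>; a \<in> E\<rbrakk> \<Longrightarrow> p a \<in> \<beta>"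
    and tau_in_iff: "a \<in> \<alpha> \<Longrightarrow> \<tau> a \<in> E \<longleftrightarrow> a \<in> E"
    and nu_in_iff: "a \<in> \<alpha> \<Longrightarrow> \<nu> a \<in> E \<longleftrightarrow> a \<in> E"
    and p_tau: "\<lbrakk>a \<in> \<alpha>; a \<in> E\<rbrakk> \<Longrightarrow> p (\<tau> a) = \<tau>' (p a)"
    and p_nu: "\<lbrakk>a \<in> \<alpha>; a \<in> E\<rbrakk> \<Longrightarrow> p (\<nu> a) = \<nu>' (p a)"
    and S_in_iff: "(a, b, c) \<in> S \<Longrightarrow> (a \<in> E \<longleftrightarrow> b \<in> E) \<and> (b \<in> E \<longleftrightarrow> c \<in> E)"
    and p_S: "\<lbrakk>(a, b, c) \<in> S; a \<in> E\<rbrakk> \<Longrightarrow> (p a, p b, p c) \<in> S'"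
begin

lemma project_funcset: "project E p \<in> nanophrases \<alpha> \<rightarrow> nanophrases \<beta>"
  by (intro Pi_I project_in_nanophrases p_in)

text \<open>The displayed letters of a move of type H1 or H2 are missing from the alphabet of the
  resulting nanophrase, so they do not occur in the undisplayed parts, and these are filtered in
  the same way before and after the move.\<close>

lemma homotopy_move_project:
  assumes "homotopy_move \<tau> S q r" "q \<in> nanophrases \<alpha>" "r \<in> nanophrases \<alpha>"
  shows "project E p q = project E p r \<or> homotopy_move \<tau>' S' (project E p q) (project E p r)"
  using assms
proof (induction rule: homotopy_move.cases)
  case (H1 x y m A)
  have "A \<notin> set (concat (x \<cdot> y))"
    using H1 by (auto simp: nanophrases_def)
  then have A: "A \<notin> set (concat x)" "A \<notin> set (concat y)"
    using H1 by (simp_all add: concat_juxtapose del: set_concat)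
  have r: "project E p r = ((relabel E p m)(A := None), keep E m x \<cdot> keep E m y)"
    using H1 A by (simp add: project_def keep_juxtapose keep_delete relabel_delete del: set_concat)
  have q: "project E p q = (relabel E p m, keep E m x \<cdot> keep E m [[A, A]] \<cdot> keep E m y)"
    using H1 by (simp add: project_def keep_juxtapose)
  show ?case
  proof (cases "\<exists>a\<in>E. m A = Some a")
    case True
    then have "keep E m [[A, A]] = [[A, A]]" by (simp add: keep_def)
    then show ?thesis unfolding q r using H1 by (auto intro: homotopy_move.H1)
  next
    case False
    then have "keep E m [[A, A]] = [[]]" by (auto simp add: keep_def)
    moreover have "(relabel E p m)(A := None) = relabel E p m"
      using False by (auto simp: relabel_def split: option.splits)
    ultimately show ?thesis unfolding q r using H1 by (simp add: juxtapose_empty_word)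
  qed
next
  case (H2 x y z m A a B b)
  have a: "a \<in> \<alpha>" using H2 by (auto simp: nanophrases_def ran_def)
  have "A \<notin> set (concat (x \<cdot> y \<cdot> z))" "B \<notin> set (concat (x \<cdot> y \<cdot> z))"
    using H2 by (auto simp: nanophrases_def)
  then have A: "A \<notin> set (concat x)" "A \<notin> set (concat y)" "A \<notin> set (concat z)"
    and B: "B \<notin> set (concat x)" "B \<notin> set (concat y)" "B \<notin> set (concat z)"
    using H2 by (simp_all add: concat_juxtapose del: set_concat)
  have r: "project E p r =
      ((relabel E p m)(A := None, B := None), keep E m x \<cdot> keep E m y \<cdot> keep E m z)"
    using H2 A B
    by (simp add: project_def keep_juxtapose keep_delete relabel_delete del: set_concat)
  have q: "project E p q = (relabel E p m,
      keep E m x \<cdot> keep E m [[A, B]] \<cdot> keep E m y \<cdot> keep E m [[B, A]] \<cdot> keep E m z)"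
    using H2 by (simp add: project_def keep_juxtapose)
  show ?case
  proof (cases "a \<in> E")
    case True
    then have b: "b \<in> E" "p b = \<tau>' (p a)" using H2 a tau_in_iff p_tau by auto
    then have "keep E m [[A, B]] = [[A, B]]" "keep E m [[B, A]] = [[B, A]]"
      using H2 True by (simp_all add: keep_def)
    then show ?thesis unfolding q r
      using H2 b True
      by (auto intro!: homotopy_move.H2[where a = "p a" and b = "p b"] simp: relabel_eq_Some)
  next
    case False
    then have b: "b \<notin> E" using H2 a tau_in_iff by auto
    then have "keep E m [[A, B]] = [[]]" "keep E m [[B, A]] = [[]]"
      using H2 False by (simp_all add: keep_def)
    moreover have "(relabel E p m)(A := None, B := None) = relabel E p m"
      using H2 False b by (auto simp: relabel_def)
    ultimately show ?thesis unfolding q r using H2 by (simp add: juxtapose_empty_word)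
  qed
next
  case (H3 x y z t m A a B b C c)
  have r: "project E p r = (relabel E p m, keep E m x \<cdot> keep E m [[B, A]] \<cdot> keep E m y \<cdot>
      keep E m [[C, A]] \<cdot> keep E m z \<cdot> keep E m [[C, B]] \<cdot> keep E m t)"
    using H3 by (simp add: project_def keep_juxtapose)
  have q: "project E p q = (relabel E p m, keep E m x \<cdot> keep E m [[A, B]] \<cdot> keep E m y \<cdot>
      keep E m [[A, C]] \<cdot> keep E m z \<cdot> keep E m [[B, C]] \<cdot> keep E m t)"
    using H3 by (simp add: project_def keep_juxtapose)
  show ?case
  proof (cases "a \<in> E")
    case True
    then have bc: "b \<in> E" "c \<in> E" using S_in_iff H3 by blast+
    have kept: "keep E m [[A, B]] = [[A, B]]" "keep E m [[A, C]] = [[A, C]]"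
      "keep E m [[B, C]] = [[B, C]]" "keep E m [[B, A]] = [[B, A]]"
      "keep E m [[C, A]] = [[C, A]]" "keep E m [[C, B]] = [[C, B]]"
      using H3 bc True by (simp_all add: keep_def)
    have "(p a, p b, p c) \<in> S'" using p_S H3 True by blast
    then have "homotopy_move \<tau>' S' (project E p q) (project E p r)"
      unfolding q r kept using H3 bc True
      by (intro homotopy_move.H3) (auto simp: relabel_eq_Some)
    then show ?thesis ..
  next
    case False
    then have "b \<notin> E" "c \<notin> E" using S_in_iff H3 by blast+
    then show ?thesis unfolding q r using H3 False by (simp add: keep_def)
  qed
qed

text \<open>The case distinction in a \<open>\<nu>\<close>-shift survives the projection because deleting other letters
  does not change how often a kept letter occurs in its word.\<close>

lemma nu_shift_project:
  assumes "nu_shift \<nu> q r" "q \<in> nanophrases \<alpha>"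
  shows "project E p q = project E p r \<or> nu_shift \<nu>' (project E p q) (project E p r)"
  using assms
proof (induction rule: nu_shift.cases)
  case (1 i ws A u m' m)
  have ran: "b \<in> \<alpha>" if "m B = Some b" for B b
    using 1 that by (auto simp: nanophrases_def ran_def)
  have "A \<in> set (ws ! i)" "ws ! i \<in> set ws" using 1(4) nth_mem[OF 1(3)] by simp_all
  then have "A \<in> set (concat ws)" by auto
  then obtain a where a: "m A = Some a" using 1 by (auto simp: nanophrases_def)
  have m': "(\<exists>b\<in>E. m' B = Some b) \<longleftrightarrow> (\<exists>b\<in>E. m B = Some b)" for B
    using 1 a ran nu_in_iff by auto
  then have keep: "keep E m' vs = keep E m vs" for vs by (rule keep_cong)
  let ?P = "\<lambda>A. \<exists>a\<in>E. m A = Some a"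
  have q: "project E p q = (relabel E p m, keep E m ws)"
    using 1 by (simp add: project_def)
  have r: "project E p r = (relabel E p m', (keep E m ws)[i := filter ?P (u @ [A])])"
    using 1 keep by (simp add: project_def) (simp add: keep_def map_update)
  have word: "keep E m ws ! i = filter ?P (A # u)"
    using 1 by (simp add: keep_def)
  show ?case
  proof (cases "a \<in> E")
    case True
    have count: "count_list (keep E m ws ! i) A = count_list (ws ! i) A"
      unfolding word using 1 a True by (subst count_list_filter) auto
    have "relabel E p m' = (if count_list (keep E m ws ! i) A = 2
        then (relabel E p m)(A := map_option \<nu>' (relabel E p m A)) else relabel E p m)"
      unfolding count using 1 a True ran nu_in_iff p_nu by (auto simp: relabel_def)
    then have "nu_shift \<nu>' (relabel E p m, keep E m ws)
        (relabel E p m', (keep E m ws)[i := filter ?P u @ [A]])"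
      using 1 a True word by (intro nu_shift.intros) (auto simp: keep_def)
    then show ?thesis unfolding q r using a True by simp
  next
    case False
    then have "relabel E p m' = relabel E p m"
      using 1 a ran nu_in_iff by (auto simp: relabel_def)
    moreover have "(keep E m ws)[i := filter ?P (u @ [A])] = keep E m ws"
      using False a word by (intro list_update_same_conv[THEN iffD2]) (auto simp: 1 keep_def)
    ultimately show ?thesis unfolding q r by simp
  qed
qed

text \<open>The letters relabelled by the projected permutation are exactly the kept ones among
  those relabelled by the original.\<close>

lemma nu_permutation_project:
  assumes "nu_permutation \<nu> q r" "q \<in> nanophrases \<alpha>"
  shows "nu_permutation \<nu>' (project E p q) (project E p r)"
  using assms
proof (induction rule: nu_permutation.cases)
  case (1 i ws m' m)
  have ran: "b \<in> \<alpha>" if "m B = Some b" for B b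
    using 1 that by (auto simp: nanophrases_def ran_def)
  have m': "(\<exists>b\<in>E. m' B = Some b) \<longleftrightarrow> (\<exists>b\<in>E. m B = Some b)" for B
    using 1 ran nu_in_iff by auto
  then have keep: "keep E m' vs = keep E m vs" for vs by (rule keep_cong)
  have q: "project E p q = (relabel E p m, keep E m ws)"
    using 1 by (simp add: project_def)
  have r: "project E p r = (relabel E p m',
      (keep E m ws)[i := keep E m ws ! Suc i, Suc i := keep E m ws ! i])"
    using 1 keep by (simp add: project_def) (simp add: keep_def map_update)
  show ?case
    unfolding q r
  proof (rule nu_permutation.intros)
    show "Suc i < length (keep E m ws)" using 1 by (simp add: keep_def)
    show "relabel E p m' = (\<lambda>A. if A \<in> set (keep E m ws ! i) \<and> A \<in> set (keep E m ws ! Suc i)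
        then map_option \<nu>' (relabel E p m A) else relabel E p m A)"
    proof
      fix A
      show "relabel E p m' A = (if A \<in> set (keep E m ws ! i) \<and> A \<in> set (keep E m ws ! Suc i)
          then map_option \<nu>' (relabel E p m A) else relabel E p m A)"
        using 1 ran[of A] nu_in_iff p_nu
        by (cases "m A") (auto simp: relabel_def keep_def)
    qed
  qed
qed

lemma project_equiv:
  fixes q r :: "('l, 'a) nanophrase"
  assumes "(q, r) \<in> nanophrase_equiv \<alpha> \<tau> S \<nu>"
  shows "(project E p q, project E p r) \<in> nanophrase_equiv \<beta> \<tau>' S' \<nu>'"
proof -
  have eqv: "equiv (nanophrases \<beta>) (S_homotopy \<beta> \<tau>' S')"
    "equiv (nanophrases \<beta>) (nanophrase_equiv \<beta> \<tau>' S' \<nu>')"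
    by (simp_all add: S_homotopy_def nanophrase_equiv_def equiv_generated_equiv)
  have in\<beta>: "project E p u \<in> nanophrases \<beta>" if "u \<in> nanophrases \<alpha>" for u :: "('l, 'a) nanophrase"
    using that project_funcset by blast
  have hom: "(project E p u, project E p v) \<in> S_homotopy \<beta> \<tau>' S'"
    if "(u, v) \<in> S_homotopy \<alpha> \<tau> S" for u v :: "('l, 'a) nanophrase"
  proof (rule generated_equiv_map[OF that[unfolded S_homotopy_def] eqv(1) project_funcset])
    fix u v :: "('l, 'a) nanophrase"
    assume uv: "u \<in> nanophrases \<alpha>" "v \<in> nanophrases \<alpha>" "isomorphic u v \<or> homotopy_move \<tau> S u v"
    then have "project E p u = project E p v \<or> isomorphic (project E p u) (project E p v) \<or>
        homotopy_move \<tau>' S' (project E p u) (project E p v)"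
      using isomorphic_project homotopy_move_project by metis
    then show "(project E p u, project E p v) \<in> S_homotopy \<beta> \<tau>' S'"
      using uv in\<beta> eqv(1) unfolding S_homotopy_def
      by (metis (mono_tags, lifting) eq_equiv_class_iff generated_equiv_base)
  qed
  show ?thesis
  proof (rule generated_equiv_map[OF assms[unfolded nanophrase_equiv_def] eqv(2) project_funcset])
    fix u v :: "('l, 'a) nanophrase"
    assume uv: "u \<in> nanophrases \<alpha>" "v \<in> nanophrases \<alpha>"
      "(u, v) \<in> S_homotopy \<alpha> \<tau> S \<or> nu_shift \<nu> u v \<or> nu_permutation \<nu> u v"
    then have "project E p u = project E p v \<or>
        (project E p u, project E p v) \<in> S_homotopy \<beta> \<tau>' S' \<or>
        nu_shift \<nu>' (project E p u) (project E p v) \<or>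
        nu_permutation \<nu>' (project E p u) (project E p v)"
      using hom nu_shift_project nu_permutation_project by metis
    then show "(project E p u, project E p v) \<in> nanophrase_equiv \<beta> \<tau>' S' \<nu>'"
      using uv in\<beta> eqv(2) unfolding nanophrase_equiv_def
      by (metis (mono_tags, lifting) eq_equiv_class_iff generated_equiv_base)
  qed
qed

end


section \<open>The maps to the target alphabets\<close>

lemma complete_representatives_unique:
  assumes "complete_representatives X E L" "equiv X E" "a \<in> L" "b \<in> L" "(a, b) \<in> E"
  shows "a = b"
proof -
  have a: "a \<in> X" using assms(1,3) by (auto simp: complete_representatives_def)
  then have "\<exists>!c. c \<in> L \<inter> E `` {a}"
    using assms(1) unfolding complete_representatives_def by (blast intro: quotientI)
  moreover have "a \<in> L \<inter> E `` {a}" "b \<in> L \<inter> E `` {a}"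
    using equiv_class_self[OF assms(2) a] assms(3-5) by simp_all
  ultimately show ?thesis by blast
qed

text \<open>On the targets, \<open>\<nu>\<tau>\<close> exchanges the signs (\<open>Star\<close>), exchanges the two symbols
  (\<open>One\<close> and \<open>Two\<close>) or is the identity (\<open>Zero\<close> and \<open>Gauss\<close>). The triples below are
  the images of the triples of \<open>S_sharp\<close> under an equivariant map.\<close>

lemma S_target_knotlike:
  assumes "s \<in> alpha_target d"
  shows "(s, s, s) \<in> S_target d"
    and "(s, s, nu_target d (tau_target d s)) \<in> S_target d"
    and "(s, nu_target d (tau_target d s), nu_target d (tau_target d s)) \<in> S_target d"
  using assms by (cases d; cases s; simp)+

context
  fixes \<alpha> L :: "'a set" and \<tau> \<nu> :: "'a \<Rightarrow> 'a"
  assumes inv_\<tau>: "involution_on \<alpha> \<tau>" and inv_\<nu>: "involution_on \<alpha> \<nu>"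
    and comm: "\<forall>a\<in>\<alpha>. \<tau> (\<nu> a) = \<nu> (\<tau> a)"
    and reps: "complete_representatives \<alpha> (orbit_equiv \<alpha> \<tau> \<nu>) L"
begin

lemma involutions:
  assumes "a \<in> \<alpha>"
  shows "\<tau> a \<in> \<alpha>" "\<nu> a \<in> \<alpha>" "\<tau> (\<tau> a) = a" "\<nu> (\<nu> a) = a" "\<nu> (\<tau> a) = \<tau> (\<nu> a)"
  using assms inv_\<tau> inv_\<nu> comm by (auto simp: involution_on_def)

lemma L_subset: "L \<subseteq> \<alpha>"
  using reps by (simp add: complete_representatives_def)

lemma L_part_subset: "L_part d \<tau> \<nu> L \<subseteq> L"
  by (cases d) auto

text \<open>These equivalences decide the case distinctions in \<open>p_map\<close>, which are phrased
  as membership in images of a part of \<open>L\<close>.\<close>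

lemma orbit_meets_L_once:
  assumes "a \<in> L"
  shows "\<tau> a \<in> L \<longleftrightarrow> \<tau> a = a" "\<nu> a \<in> L \<longleftrightarrow> \<nu> a = a" "\<tau> (\<nu> a) \<in> L \<longleftrightarrow> \<tau> (\<nu> a) = a"
proof -
  have eqv: "equiv \<alpha> (orbit_equiv \<alpha> \<tau> \<nu>)"
    by (simp add: orbit_equiv_def equiv_generated_equiv)
  have a: "a \<in> \<alpha>" using assms L_subset by blast
  have step: "(b, \<tau> b) \<in> orbit_equiv \<alpha> \<tau> \<nu>" "(b, \<nu> b) \<in> orbit_equiv \<alpha> \<tau> \<nu>" if "b \<in> \<alpha>" for b
    using that involutions by (auto simp: orbit_equiv_def intro!: generated_equiv_base)
  have "(a, \<tau> (\<nu> a)) \<in> orbit_equiv \<alpha> \<tau> \<nu>"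
    using step(2)[OF a] step(1)[OF involutions(2)[OF a]] eqv by (meson equivE transD)
  then show "\<tau> a \<in> L \<longleftrightarrow> \<tau> a = a" "\<nu> a \<in> L \<longleftrightarrow> \<nu> a = a" "\<tau> (\<nu> a) \<in> L \<longleftrightarrow> \<tau> (\<nu> a) = a"
    using complete_representatives_unique[OF reps eqv assms] step[OF a] assms by metis+
qed

lemma eta_cases:
  assumes "a \<in> eta d \<tau> \<nu> L"
  obtains x where "x \<in> L_part d \<tau> \<nu> L" "x \<in> \<alpha>" "a = x \<or> a = \<tau> x \<or> a = \<nu> x \<or> a = \<tau> (\<nu> x)"
proof -
  obtain x where "x \<in> L_part d \<tau> \<nu> L" "a = x \<or> a = \<tau> x \<or> a = \<nu> x \<or> a = \<tau> (\<nu> x)"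
    using assms unfolding eta_def by force
  then show thesis using that L_part_subset L_subset by blast
qed

lemma eta_closed:
  assumes "a \<in> eta d \<tau> \<nu> L"
  shows "\<tau> a \<in> eta d \<tau> \<nu> L" "\<nu> a \<in> eta d \<tau> \<nu> L"
proof -
  obtain x where x: "x \<in> L_part d \<tau> \<nu> L" "x \<in> \<alpha>" and a: "a = x \<or> a = \<tau> x \<or> a = \<nu> x \<or> a = \<tau> (\<nu> x)"
    using assms by (rule eta_cases)
  have "x \<in> eta d \<tau> \<nu> L" "\<tau> x \<in> eta d \<tau> \<nu> L" "\<nu> x \<in> eta d \<tau> \<nu> L" "\<tau> (\<nu> x) \<in> eta d \<tau> \<nu> L"
    using x(1) by (auto simp: eta_def)
  then show "\<tau> a \<in> eta d \<tau> \<nu> L" "\<nu> a \<in> eta d \<tau> \<nu> L"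
    using a x(2) by (auto simp: involutions)
qed

text \<open>Equivariance at the base point of an orbit; the point is that the branches of \<open>p_map\<close> do not
  overlap. In the case \<open>Star\<close> the four points of the orbit are distinct and only \<open>x\<close> lies in
  \<open>L\<close>, so an overlap would give a second point of the orbit in \<open>L\<close>.\<close>

lemma p_map_orbit:
  assumes "x \<in> L_part d \<tau> \<nu> L"
  shows "p_map d \<tau> \<nu> L (\<tau> x) = tau_target d (p_map d \<tau> \<nu> L x)"
    and "p_map d \<tau> \<nu> L (\<nu> x) = nu_target d (p_map d \<tau> \<nu> L x)"
    and "p_map d \<tau> \<nu> L (\<tau> (\<nu> x)) = tau_target d (nu_target d (p_map d \<tau> \<nu> L x))"
proof -
  have x: "x \<in> L" "x \<in> \<alpha>" using assms L_part_subset L_subset by blast+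
  note orbit = orbit_meets_L_once[OF x(1)] involutions[OF x(2)]
  have "p_map d \<tau> \<nu> L (\<tau> x) = tau_target d (p_map d \<tau> \<nu> L x) \<and>
    p_map d \<tau> \<nu> L (\<nu> x) = nu_target d (p_map d \<tau> \<nu> L x) \<and>
    p_map d \<tau> \<nu> L (\<tau> (\<nu> x)) = tau_target d (nu_target d (p_map d \<tau> \<nu> L x))"
  proof (cases d)
    case Star
    let ?P = "L_part Star \<tau> \<nu> L"
    have ne: "\<tau> x \<noteq> x" "\<nu> x \<noteq> x" "\<tau> x \<noteq> \<nu> x" and xP: "x \<in> ?P" using assms Star by auto
    then have "\<tau> (\<nu> x) \<noteq> x" using involutions x by metis
    with ne orbit(1-3) have notL: "\<tau> x \<notin> L" "\<nu> x \<notin> L" "\<tau> (\<nu> x) \<notin> L" by simp_all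
    then have notP: "\<tau> x \<notin> ?P" "\<nu> x \<notin> ?P" "\<tau> (\<nu> x) \<notin> ?P" by auto
    have sub: "y \<in> L" "y \<in> \<alpha>" if "y \<in> ?P" for y
      using that L_part_subset L_subset by blast+
    have "\<tau> x \<notin> \<nu> ` ?P"
    proof
      assume "\<tau> x \<in> \<nu> ` ?P"
      then obtain y where "y \<in> ?P" "\<tau> x = \<nu> y" by blast
      then have "\<tau> (\<nu> x) = y" using sub involutions x by metis
      with notP \<open>y \<in> ?P\<close> show False by simp
    qed
    moreover have "\<tau> x \<notin> (\<tau> \<circ> \<nu>) ` ?P"
    proof
      assume "\<tau> x \<in> (\<tau> \<circ> \<nu>) ` ?P"
      then obtain y where "y \<in> ?P" "\<tau> x = \<tau> (\<nu> y)" by auto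
      then have "\<nu> x = y" using sub involutions x by metis
      with notP \<open>y \<in> ?P\<close> show False by simp
    qed
    moreover have "\<tau> (\<nu> x) \<notin> \<nu> ` ?P"
    proof
      assume "\<tau> (\<nu> x) \<in> \<nu> ` ?P"
      then obtain y where "y \<in> ?P" "\<tau> (\<nu> x) = \<nu> y" by blast
      then have "\<tau> x = y" using sub involutions x by metis
      with notP \<open>y \<in> ?P\<close> show False by simp
    qed
    moreover have "\<nu> x \<in> \<nu> ` ?P" "\<tau> (\<nu> x) \<in> (\<tau> \<circ> \<nu>) ` ?P" using xP by auto
    ultimately show ?thesis
      using notP xP unfolding Star p_map.simps by (simp del: L_part.simps)
  next
    case Zero
    then show ?thesis using assms orbit by auto
  next
    case One
    then show ?thesis using assms orbit by auto
  next
    case Two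
    then show ?thesis using assms orbit by auto
  next
    case Gauss
    then show ?thesis by simp
  qed
  then show "p_map d \<tau> \<nu> L (\<tau> x) = tau_target d (p_map d \<tau> \<nu> L x)"
    "p_map d \<tau> \<nu> L (\<nu> x) = nu_target d (p_map d \<tau> \<nu> L x)"
    "p_map d \<tau> \<nu> L (\<tau> (\<nu> x)) = tau_target d (nu_target d (p_map d \<tau> \<nu> L x))"
    by simp_all
qed

text \<open>Equivariance propagates from the base point to its orbit because the involutions of the
  target commute as well.\<close>

lemma p_map_equivariant:
  assumes "a \<in> eta d \<tau> \<nu> L"
  shows "p_map d \<tau> \<nu> L (\<tau> a) = tau_target d (p_map d \<tau> \<nu> L a)"
    and "p_map d \<tau> \<nu> L (\<nu> a) = nu_target d (p_map d \<tau> \<nu> L a)"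
proof -
  obtain x where x: "x \<in> L_part d \<tau> \<nu> L" "x \<in> \<alpha>" and a: "a = x \<or> a = \<tau> x \<or> a = \<nu> x \<or> a = \<tau> (\<nu> x)"
    using assms by (rule eta_cases)
  have tt: "tau_target d (tau_target d s) = s" "nu_target d (nu_target d s) = s"
     "nu_target d (tau_target d s) = tau_target d (nu_target d s)" for s
    by (cases d; cases s; simp)+
  show "p_map d \<tau> \<nu> L (\<tau> a) = tau_target d (p_map d \<tau> \<nu> L a)"
    "p_map d \<tau> \<nu> L (\<nu> a) = nu_target d (p_map d \<tau> \<nu> L a)"
    using a p_map_orbit[OF x(1)] x(2)
    by (elim disjE; simp add: involutions tt del: p_map.simps tau_target.simps nu_target.simps)+
qed

lemma p_map_in_alpha_target: "p_map d \<tau> \<nu> L a \<in> alpha_target d"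
  by (cases d) auto

lemma homotopy_data_map_F:
  "homotopy_data_map \<alpha> \<tau> \<nu> (S_sharp \<alpha> \<tau> \<nu>) (alpha_target d) (tau_target d) (nu_target d)
     (S_target d) (eta d \<tau> \<nu> L) (p_map d \<tau> \<nu> L)"
proof
  show tau: "\<tau> a \<in> eta d \<tau> \<nu> L \<longleftrightarrow> a \<in> eta d \<tau> \<nu> L" if "a \<in> \<alpha>" for a
    using eta_closed(1) involutions(3) that by metis
  show nu: "\<nu> a \<in> eta d \<tau> \<nu> L \<longleftrightarrow> a \<in> eta d \<tau> \<nu> L" if "a \<in> \<alpha>" for a
    using eta_closed(2) involutions(4) that by metis
  show "p_map d \<tau> \<nu> L a \<in> alpha_target d" for a
    by (rule p_map_in_alpha_target)
  show "p_map d \<tau> \<nu> L (\<tau> a) = tau_target d (p_map d \<tau> \<nu> L a)"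
    "p_map d \<tau> \<nu> L (\<nu> a) = nu_target d (p_map d \<tau> \<nu> L a)" if "a \<in> eta d \<tau> \<nu> L" for a
    using that by (rule p_map_equivariant)+
  fix a b c
  assume abc: "(a, b, c) \<in> S_sharp \<alpha> \<tau> \<nu>"
  then have a: "a \<in> \<alpha>" and bc: "(b, c) \<in> {(a, a), (a, \<nu> (\<tau> a)), (\<nu> (\<tau> a), \<nu> (\<tau> a))}"
    by (auto simp: S_sharp_def)
  show "(a \<in> eta d \<tau> \<nu> L \<longleftrightarrow> b \<in> eta d \<tau> \<nu> L) \<and> (b \<in> eta d \<tau> \<nu> L \<longleftrightarrow> c \<in> eta d \<tau> \<nu> L)"
    using a bc tau nu involutions(1) by auto
  assume "a \<in> eta d \<tau> \<nu> L"
  then have "p_map d \<tau> \<nu> L (\<nu> (\<tau> a)) = nu_target d (tau_target d (p_map d \<tau> \<nu> L a))"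
    using p_map_equivariant eta_closed by metis
  then show "(p_map d \<tau> \<nu> L a, p_map d \<tau> \<nu> L b, p_map d \<tau> \<nu> L c) \<in> S_target d"
    using bc S_target_knotlike[OF p_map_in_alpha_target] by auto
qed

end

theorem theorem1:
  fixes \<alpha> L :: "'a set"
    and \<tau> \<nu> :: "'a \<Rightarrow> 'a"
    and d :: diamond
  assumes "finite \<alpha>"
    and "involution_on \<alpha> \<tau>"
    and "involution_on \<alpha> \<nu>"
    and "\<forall>a\<in>\<alpha>. \<tau> (\<nu> a) = \<nu> (\<tau> a)"
    and "complete_representatives \<alpha> (orbit_equiv \<alpha> \<tau> \<nu>) L"
  shows "F_map d \<tau> \<nu> L \<in> (nanophrases \<alpha> :: ('l, 'a) nanophrase set) \<rightarrow> nanophrases (alpha_target d) \<and>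
    (\<exists>!\<Phi>. \<Phi> \<in> (nanophrase_classes \<alpha> \<tau> (S_sharp \<alpha> \<tau> \<nu>) \<nu> :: ('l, 'a) nanophrase set set) \<rightarrow>\<^sub>E
              nanophrase_classes (alpha_target d) (tau_target d) (S_target d) (nu_target d) \<and>
         (\<forall>p\<in>nanophrases \<alpha>.
            \<Phi> (nanophrase_equiv \<alpha> \<tau> (S_sharp \<alpha> \<tau> \<nu>) \<nu> `` {p}) =
            nanophrase_equiv (alpha_target d) (tau_target d) (S_target d) (nu_target d)
              `` {F_map d \<tau> \<nu> L p}))"
proof -
  interpret homotopy_data_map \<alpha> \<tau> \<nu> "S_sharp \<alpha> \<tau> \<nu>" "alpha_target d" "tau_target d" "nu_target d"
    "S_target d" "eta d \<tau> \<nu> L" "p_map d \<tau> \<nu> L"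
    using assms(2-5) by (rule homotopy_data_map_F)
  show ?thesis
    unfolding F_map_eq_project nanophrase_classes_def
    using project_funcset project_equiv
    by (intro conjI ex1_induced_quotient_map)
       (simp_all add: nanophrase_equiv_def equiv_generated_equiv)
qed

end
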